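(* Let $n\ge 1$ be a positive integer and $q=2^n$. Then the power function $F(x)=x^{q^3+q^2+q-1}$ over $\mathbb{F}_{q^4}$ is a permutation of $\mathbb{F}_{q^4}$, and for each $c\in\mu_{q^2+1}\setminus\{1\}$ it is almost perfect $c$-nonlinear (APcN), i.e. ${}_c\Delta_F=2$.
   Context: $\mu_{q^2+1}=\{x\in\mathbb{F}_{q^4}^{*}: x^{q^2+1}=1\}$. For a prime power $Q$, a function $F:\mathbb{F}_Q\to\mathbb{F}_Q$ and $c\in\mathbb{F}_Q$, the $c$-derivative of $F$ with respect to $a\in\mathbb{F}_Q$ is ${}_cD_aF(x)=F(x+a)-cF(x)$. Put ${}_c\Delta_F(a,b)=\#\{x\in\mathbb{F}_Q: {}_cD_aF(x)=b\}$. For $c\neq 1$ put ${}_c\Delta_F=\max_{a,b\in\mathbb{F}_Q}{}_c\Delta_F(a,b)$. $F$ is called almost perfect $c$-nonlinear (APcN) if ${}_c\Delta_F=2$. Here $Q=q^4$. *)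

theory Defs
  imports "HOL-Library.Cardinality"
begin

definition c_derivative :: "'a::field \<Rightarrow> 'a \<Rightarrow> ('a \<Rightarrow> 'a) \<Rightarrow> 'a \<Rightarrow> 'a" where
  "c_derivative c a F x = F (x + a) - c * F x"

definition c_delta_at :: "'a::{field,finite} \<Rightarrow> ('a \<Rightarrow> 'a) \<Rightarrow> 'a \<Rightarrow> 'a \<Rightarrow> nat" where
  "c_delta_at c F a b = card {x. c_derivative c a F x = b}"

text \<open>The maximum below includes \<open>a = 0\<close>. This is the c-differential uniformity for \<open>c \<noteq> 1\<close>
  only; the notion for \<open>c = 1\<close> (not needed here) excludes \<open>a = 0\<close>.\<close>

definition c_delta :: "'a::{field,finite} \<Rightarrow> ('a \<Rightarrow> 'a) \<Rightarrow> nat" where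
  "c_delta c F = Max {c_delta_at c F a b | a b. True}"

definition APcN :: "'a::{field,finite} \<Rightarrow> ('a \<Rightarrow> 'a) \<Rightarrow> bool" where
  "APcN c F \<longleftrightarrow> c_delta c F = 2"

definition mu :: "nat \<Rightarrow> 'a::field set" where
  "mu m = {x. x \<noteq> 0 \<and> x ^ m = 1}"

end

theory Submission
  imports Defs
begin

text \<open>
  Let \<open>\<phi> x = x ^ q\<close> and write \<open>bar x\<close> for \<open>\<phi> (\<phi> x)\<close>, \<open>nrm x = x * bar x\<close>. Every \<open>x\<close> has \<open>nrm x = \<alpha> * m\<close> with
  \<open>\<phi> \<alpha> = \<alpha>\<close> and \<open>m * \<phi> m = 1\<close>, and then \<open>F x = (bar x / m)\<^sup>2\<close>. Taking square roots,
  \<open>F (x + 1) + c * F x = \<beta>\<close> becomes the equation \<open>(x + 1) / k + g * x / m = d\<close>, which is linear in \<open>x\<close>, where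
  \<open>bar g ^ 2 = c\<close>, \<open>bar d ^ 2 = \<beta>\<close>, and \<open>k\<close> is the unit belonging to \<open>x + 1\<close>. So \<open>x\<close> is determined by
  \<open>(m, k)\<close>, and the two norm conditions turn into
  \<open>J t * k + \<phi> (J t) / k = rhs b t\<close> and \<open>J t * m + \<phi> (J t) / m = rhs a t\<close> with \<open>t = m / k + k / m\<close>, \<open>d = a + b * g\<close>.
  Eliminating \<open>m\<close> and \<open>k\<close> leaves a quadratic equation for \<open>t\<close>. The condition \<open>c \<noteq> 1\<close> says that
  \<open>1 / G + 1 / \<phi> G\<close>, for \<open>G = g + bar g\<close>, is not of the form \<open>h\<^sup>2 + h\<close> with \<open>\<phi> h = h\<close>, whereas
  \<open>1 / t = l\<^sup>2 + l\<close> with \<open>\<phi> l = l + 1\<close>; comparing this with the sum of the roots shows that all solutions share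
  the same \<open>t\<close>. Then \<open>m / k\<close> has at most two values, which are exchanged by an involution of the
  solutions; applied to \<open>x = G\<close>, the involution produces two distinct solutions.
  Bijectivity of \<open>F\<close> follows from \<open>F (F x) = x ^ 4\<close>.
\<close>

section \<open>Counting in finite sets and finite-field preliminaries\<close>

lemma card_le_2I:
  assumes "finite S" "\<And>x y z. x \<in> S \<Longrightarrow> y \<in> S \<Longrightarrow> z \<in> S \<Longrightarrow> x = y \<or> x = z \<or> y = z"
  shows "card S \<le> 2"
proof (rule ccontr)
  assume "\<not> card S \<le> 2"
  then have "3 \<le> card S"
    by simp
  then obtain T where "T \<subseteq> S" "card T = 3"
    by (meson obtain_subset_with_card_n)
  then obtain x y z where "{x, y, z} \<subseteq> S" "x \<noteq> y" "x \<noteq> z" "y \<noteq> z"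
    unfolding card_3_iff by blast
  with assms(2)[of x y z] show False
    by simp
qed

lemma power_add_power_of_two:
  fixes x y :: "'a::comm_semiring_1"
  assumes "(1 + 1 :: 'a) = 0"
  shows "(x + y) ^ 2 ^ n = x ^ 2 ^ n + y ^ 2 ^ n"
proof (induction n)
  case (Suc n)
  have "(u + v)\<^sup>2 = u\<^sup>2 + v\<^sup>2" for u v :: 'a
  proof -
    have "(u + v)\<^sup>2 = u\<^sup>2 + v\<^sup>2 + (1 + 1) * (u * v)"
      by (simp only: power2_eq_square distrib_left distrib_right mult_1_left ac_simps)
    then show ?thesis
      by (simp only: assms mult_zero_left add_0_right)
  qed
  then show ?case
    using Suc by (simp only: power_Suc2 power_mult)
qed simp

lemma finite_field_power_CARD:
  fixes x :: "'a::{field,finite}"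
  shows "x ^ CARD('a) = x"
proof (cases "x = 0")
  case False
  let ?P = "\<Prod>(UNIV - {0 :: 'a})"
  have "bij_betw (\<lambda>y. x * y) (UNIV - {0}) (UNIV - {0})"
    using False by (intro bij_betw_byWitness[where f' = "\<lambda>y. y / x"]) auto
  then have "?P = (\<Prod>y\<in>UNIV - {0}. x * y)"
    by (rule prod.reindex_bij_betw[symmetric])
  also have "\<dots> = x ^ (CARD('a) - 1) * ?P"
    by (simp add: prod.distrib card_Diff_singleton)
  finally have "x ^ (CARD('a) - 1) = 1"
    by simp
  then show ?thesis
    using power_minus_mult[of "CARD('a)" x] by (simp add: finite_UNIV_card_ge_0)
qed (simp add: finite_UNIV_card_ge_0)

subsection \<open>Fields of characteristic 2 with an automorphism of order dividing 4\<close>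

locale quartic_frobenius =
  fixes \<phi> :: "'a::field \<Rightarrow> 'a"
  assumes one_add_one [simp]: "1 + 1 = (0 :: 'a)"
    and phi_add [simp]: "\<phi> (x + y) = \<phi> x + \<phi> y"
    and phi_mult [simp]: "\<phi> (x * y) = \<phi> x * \<phi> y"
    and phi_0 [simp]: "\<phi> 0 = 0"
    and phi_1 [simp]: "\<phi> 1 = 1"
    and phi_phi_phi_phi [simp]: "\<phi> (\<phi> (\<phi> (\<phi> x))) = x"
    and ex_sqrt: "\<exists>y. y\<^sup>2 = x"
begin

lemma add_self [simp]: "x + x = (0 :: 'a)"
  by (metis distrib_left mult.right_neutral mult_zero_right one_add_one)

lemma add_self_left [simp]: "x + (x + y) = (y :: 'a)"
  by (simp flip: add.assoc)

lemma uminus_eq: "- x = (x :: 'a)"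
  by (rule minus_unique) simp

lemma diff_eq: "x - y = x + (y :: 'a)"
  by (metis diff_conv_add_uminus uminus_eq)

lemma add_eq_0: "x + y = 0 \<longleftrightarrow> x = (y :: 'a)"
  using right_minus_eq[of x y] by (simp only: diff_eq)

lemmas expand = distrib_left distrib_right power2_eq_square add_ac mult_ac

lemma power2_add: "(x + y)\<^sup>2 = x\<^sup>2 + (y :: 'a)\<^sup>2"
  by (simp add: expand)

lemma power2_inj: "x\<^sup>2 = y\<^sup>2 \<longleftrightarrow> x = (y :: 'a)"
  by (metis add_eq_0 power2_add power_eq_0_iff zero_neq_numeral)

lemma phi_power [simp]: "\<phi> (x ^ n) = \<phi> x ^ n"
  by (induction n) auto

lemma phi_inj [simp]: "\<phi> x = \<phi> y \<longleftrightarrow> x = y"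
  by (metis phi_phi_phi_phi)

lemma phi_eq_0 [simp]: "\<phi> x = 0 \<longleftrightarrow> x = 0"
  by (metis phi_0 phi_inj)

lemma phi_divide [simp]: "\<phi> (x / y) = \<phi> x / \<phi> y"
proof (cases "y = 0")
  case False
  then have "\<phi> (x / y) * \<phi> y = \<phi> x"
    by (simp flip: phi_mult)
  with False show ?thesis
    by (simp add: eq_divide_eq)
qed simp

definition nrm :: "'a \<Rightarrow> 'a" where
  "nrm x = x * \<phi> (\<phi> x)"

definition trc :: "'a \<Rightarrow> 'a" where
  "trc x = x + \<phi> (\<phi> x)"

lemma nrm_eq_0 [simp]: "nrm x = 0 \<longleftrightarrow> x = 0"
  by (simp add: nrm_def)

lemma phi_phi_nrm [simp]: "\<phi> (\<phi> (nrm x)) = nrm x"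
  by (simp add: nrm_def mult.commute)

lemma phi_phi_trc [simp]: "\<phi> (\<phi> (trc x)) = trc x"
  by (simp add: trc_def add.commute)

section \<open>Artin-Schreier elements and the elimination identities\<close>

lemma artin_schreier_mixed:
  assumes "l\<^sub>1\<^sup>2 + l\<^sub>1 + (l\<^sub>2\<^sup>2 + l\<^sub>2) = \<eta> + h\<^sup>2 + h" "\<phi> l\<^sub>1 = l\<^sub>1 + 1" "\<phi> l\<^sub>2 = l\<^sub>2 + 1" "\<phi> h = h"
  shows "\<exists>h. \<phi> h = h \<and> h\<^sup>2 + h = \<eta>"
proof (intro exI conjI)
  have "\<eta> = l\<^sub>1\<^sup>2 + l\<^sub>1 + (l\<^sub>2\<^sup>2 + l\<^sub>2) + h\<^sup>2 + h"
    using assms(1) by (simp add: add_ac)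
  then show "(l\<^sub>1 + l\<^sub>2 + h)\<^sup>2 + (l\<^sub>1 + l\<^sub>2 + h) = \<eta>"
    by (simp add: expand)
  \<comment> \<open>The shifts by \<open>1\<close> of the two roots cancel in characteristic
    2.\<close>
  show "\<phi> (l\<^sub>1 + l\<^sub>2 + h) = l\<^sub>1 + l\<^sub>2 + h"
    by (simp add: assms add_ac)
qed

text \<open>Eliminates two units, with \<open>m'\<close> and \<open>k'\<close> as their inverses.
  Multiplying \<open>j * i\<close> by \<open>t\<close> turns mixed products into squares through
  \<open>k * m * t = m^2 + k^2\<close>, and these squares reassemble to
  \<open>j^2 + i^2\<close>.\<close>

lemma conic_resultant:
  fixes m m' k k' t i j J J' :: 'a
  assumes mm: "m * m' = 1" and kk: "k * k' = 1" and t: "t = m * k' + k * m'"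
    and j: "J * k + J' * k' = j" and i: "J * m + J' * m' = i"
  shows "j\<^sup>2 + i\<^sup>2 + j * i * t + t\<^sup>2 * (J * J') = 0"
proof -
  have "k * m * t = m\<^sup>2 * (k * k') + k\<^sup>2 * (m * m')" "k' * m' * t = k'\<^sup>2 * (m * m') + m'\<^sup>2 * (k * k')"
    by (simp_all add: t expand)
  then have kmt: "k * m * t = m\<^sup>2 + k\<^sup>2" "k' * m' * t = k'\<^sup>2 + m'\<^sup>2"
    by (simp_all add: mm kk)
  have "j * i = J\<^sup>2 * (k * m) + J'\<^sup>2 * (k' * m') + J * J' * t"
    by (simp add: i[symmetric] j[symmetric] t expand)
  then have "j * i * t = J\<^sup>2 * (k * m * t) + J'\<^sup>2 * (k' * m' * t) + t\<^sup>2 * (J * J')"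
    by (simp add: expand)
  also have "\<dots> = J\<^sup>2 * (m\<^sup>2 + k\<^sup>2) + J'\<^sup>2 * (k'\<^sup>2 + m'\<^sup>2) + t\<^sup>2 * (J * J')"
    by (simp only: kmt)
  also have "\<dots> = j\<^sup>2 + i\<^sup>2 + t\<^sup>2 * (J * J')"
    by (simp add: i[symmetric] j[symmetric] expand)
  finally show ?thesis
    by (simp add: add_ac)
qed

text \<open>Here \<open>e\<close> and \<open>e'\<close> stand for \<open>G\<close> and
  \<open>\<phi> G\<close>. The eliminant is formally of degree 4 in \<open>t\<close>, but the
  factors \<open>e + t\<close> and \<open>e' + t\<close> do not vanish for fixed \<open>t\<close>,
  so only a quadratic equation remains.\<close>

lemma resultant_factorization:
  fixes a a' b b' d d' e e' t :: 'a
  defines "D \<equiv> a\<^sup>2 + b\<^sup>2 + a * b * e" and "D' \<equiv> a'\<^sup>2 + b'\<^sup>2 + a' * b' * e'"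
  defines "J \<equiv> D * (e' + t) + (e + t)" and "J' \<equiv> D' * (e + t) + (e' + t)"
    and "j \<equiv> b * e * (e' + t) + b' * e' * (e + t)" and "i \<equiv> a * e * (e' + t) + a' * e' * (e + t)"
  shows "j\<^sup>2 + i\<^sup>2 + j * i * t + t\<^sup>2 * (J * J') =
    (e + t) * (e' + t) *
      ((1 + D) * (1 + D') * t\<^sup>2
       + ((e + e') * (a + a' + b + b')\<^sup>2 + e * e' * (a + a') * (b + b')) * t
       + e * e' * (a + a' + b + b')\<^sup>2)"
  unfolding assms by (simp add: expand)

lemma artin_schreier_quotient:
  fixes x y :: 'a
  assumes "x + y \<noteq> 0"
  shows "(x / (x + y))\<^sup>2 + x / (x + y) = x * y / (x + y)\<^sup>2"
proof -
  have "(x / (x + y))\<^sup>2 + x / (x + y) = (x\<^sup>2 + x * (x + y)) / (x + y)\<^sup>2"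
    using assms by (simp add: add_divide_distrib power_divide power2_eq_square)
  then show ?thesis
    by (simp add: expand)
qed

lemma quadratic_three_roots:
  fixes p r s x y z :: 'a
  assumes "p \<noteq> 0" "p * x\<^sup>2 + r * x + s = 0" "p * y\<^sup>2 + r * y + s = 0" "p * z\<^sup>2 + r * z + s = 0"
  shows "x = y \<or> x = z \<or> y = z"
proof (rule ccontr)
  assume neq: "\<not> ?thesis"
  have *: "p * (u + v) = r"
    if "u \<noteq> v" "p * u\<^sup>2 + r * u + s = 0" "p * v\<^sup>2 + r * v + s = 0" for u v
  proof -
    have "(u + v) * (p * (u + v) + r) = (p * u\<^sup>2 + r * u + s) + (p * v\<^sup>2 + r * v + s)"
      by (simp add: expand)
    with that show ?thesis
      by (simp add: add_eq_0)
  qed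
  have "p * (x + y) = p * (x + z)"
    using *[of x y] *[of x z] assms neq by simp
  with assms(1) neq show False
    by simp
qed

text \<open>Since \<open>\<phi>\<close> inverts units, for units this is the trace of
  \<open>m / k\<close> down to the fixed field of \<open>\<phi>\<close>.\<close>

definition cross :: "'a \<Rightarrow> 'a \<Rightarrow> 'a" where
  "cross m k = m * \<phi> k + k * \<phi> m"

lemma
  assumes "m * \<phi> m = 1" "k * \<phi> k = 1"
  shows phi_cross: "\<phi> (cross m k) = cross m k"
    and cross_mult: "cross m k * (m * k) = (m + k)\<^sup>2"
    and cross_eq_0: "cross m k = 0 \<longleftrightarrow> m = k"
    and cross_artin_schreier:
      "m \<noteq> k \<Longrightarrow> \<exists>l. \<phi> l = l + 1 \<and> l\<^sup>2 + l = 1 / cross m k"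
proof -
  have nz: "m \<noteq> 0" "k \<noteq> 0"
    using assms by auto
  then have phi: "\<phi> m = 1 / m" "\<phi> k = 1 / k"
    using assms by (auto simp: eq_divide_eq mult.commute)
  show "\<phi> (cross m k) = cross m k"
    using nz by (simp add: cross_def phi add.commute mult.commute)
  have "cross m k * (m * k) = m\<^sup>2 * (k * \<phi> k) + k\<^sup>2 * (m * \<phi> m)"
    by (simp add: cross_def expand)
  then show 1: "cross m k * (m * k) = (m + k)\<^sup>2"
    using assms by (simp add: power2_add)
  then show "cross m k = 0 \<longleftrightarrow> m = k"
    using nz by (metis add_eq_0 mult_eq_0_iff zero_eq_power2)
  assume "m \<noteq> k"
  then have mk: "m + k \<noteq> 0"
    by (simp add: add_eq_0)
  have "cross m k = (m + k)\<^sup>2 / (m * k)"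
    using 1 nz by (simp add: eq_divide_eq)
  then have "(m / (m + k))\<^sup>2 + m / (m + k) = 1 / cross m k"
    using mk by (simp add: artin_schreier_quotient)
  \<comment> \<open>Inverting \<open>m\<close> and \<open>k\<close> swaps \<open>m / (m + k)\<close>
    with \<open>k / (m + k)\<close>, and these add up to \<open>1\<close>.\<close>
  moreover have "\<phi> (m / (m + k)) = m / (m + k) + 1"
  proof -
    have "\<phi> (m / (m + k)) = (1 / m) / (1 / m + 1 / k)"
      by (simp add: phi)
    also have "\<dots> = k / (m + k)"
      using nz mk by (simp add: divide_simps add_ac)
    also have "\<dots> = m / (m + k) + 1"
      using mk by (simp add: divide_simps add_ac)
    finally show ?thesis .
  qed
  ultimately show "\<exists>l. \<phi> l = l + 1 \<and> l\<^sup>2 + l = 1 / cross m k"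
    by blast
qed

lemma phi_phi_unit: "m * \<phi> m = 1 \<Longrightarrow> \<phi> (\<phi> m) = m"
proof -
  assume m: "m * \<phi> m = 1"
  then have "\<phi> (m * \<phi> m) = m * \<phi> m"
    by (simp only: phi_1)
  then have "\<phi> m * \<phi> (\<phi> m) = \<phi> m * m"
    by (simp add: mult.commute)
  moreover have "\<phi> m \<noteq> 0"
    using m by auto
  ultimately show ?thesis
    by simp
qed

lemma nrm_mult: "nrm (x * y) = nrm x * nrm y"
  by (simp add: nrm_def mult_ac)

lemma nrm_divide: "nrm (x / y) = nrm x / nrm y"
  by (simp add: nrm_def)

text \<open>Meant for \<open>n\<close> the norm of a fraction whose numerator has norm
  \<open>v * z\<close> and whose denominator has norm \<open>\<phi> u * v * e\<close>:
  \<open>v\<close> cancels, and \<open>\<phi> u\<close> is the inverse of \<open>u\<close>.\<close>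

lemma nrm_eq_iff:
  fixes u v e n z \<alpha> :: 'a
  assumes "u * \<phi> u = 1" "v \<noteq> 0" "e \<noteq> 0" "n * (\<phi> u * v * e) = v * z"
  shows "n = \<alpha> * u \<longleftrightarrow> z = \<alpha> * e"
proof -
  have "v * (n * \<phi> u * e) = v * z"
    using assms(4) by (simp add: mult_ac)
  then have z: "z = n * \<phi> u * e"
    using assms(2) by simp
  have u: "\<phi> u \<noteq> 0"
    using assms(1) by auto
  have "z = \<alpha> * e \<longleftrightarrow> n * \<phi> u = \<alpha> * u * \<phi> u"
    using assms(1,3) by (simp add: z mult.assoc)
  with u show ?thesis
    by simp
qed

end

subsection \<open>Elements of norm 1\<close>

locale unit_rotation = quartic_frobenius +
  fixes g :: 'a
  assumes nrm_g [simp]: "nrm g = 1" and g_neq_1: "g \<noteq> 1"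
begin

abbreviation "G \<equiv> trc g"
abbreviation "G' \<equiv> \<phi> (trc g)"

lemma G_neq_0 [simp]: "G \<noteq> 0"
proof
  assume "G = 0"
  then have "\<phi> (\<phi> g) = g"
    by (simp add: trc_def add_eq_0)
  with nrm_g have "g\<^sup>2 = 1\<^sup>2"
    by (simp add: nrm_def power2_eq_square)
  with g_neq_1 show False
    by (simp only: power2_inj)
qed

text \<open>
  The solutions of \<open>y\<^sup>2 + y = 1 / G\<close> are \<open>g / (g + 1)\<close> and \<open>1 / (g + 1)\<close>, and \<open>\<phi> \<circ> \<phi>\<close> exchanges them;
  an \<open>h\<close> as below would equal \<open>y + \<phi> y\<close> or \<open>y + \<phi> y + 1\<close>, which makes \<open>y\<close> fixed.
\<close>

lemma not_artin_schreier:
  assumes "\<phi> h = h"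
  shows "h\<^sup>2 + h \<noteq> 1 / G + 1 / G'"
proof
  assume h: "h\<^sup>2 + h = 1 / G + 1 / G'"
  define y where "y = g / (g + 1)"
  have g1: "g + 1 \<noteq> 0"
    using g_neq_1 by (simp add: add_eq_0)
  have gg: "g * \<phi> (\<phi> g) = 1"
    using nrm_g by (simp add: nrm_def)
  have "g * G = (g + 1)\<^sup>2"
    using gg by (simp add: trc_def expand)
  then have "g / (g + 1)\<^sup>2 = 1 / G"
    using g1 by (simp add: frac_eq_eq)
  moreover have "y\<^sup>2 + y = g / (g + 1)\<^sup>2"
    using g1 by (simp add: y_def power_divide divide_simps) (simp add: expand)
  ultimately have y: "y\<^sup>2 + y = 1 / G"
    by simp
  then have "\<phi> (y\<^sup>2 + y) = \<phi> (1 / G)"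
    by (rule arg_cong)
  then have "\<phi> y ^ 2 + \<phi> y = 1 / G'"
    by (simp only: phi_add phi_power phi_divide phi_1)
  with y h have "h\<^sup>2 + h = (y\<^sup>2 + y) + (\<phi> y ^ 2 + \<phi> y)"
    by simp
  moreover have "(h + y + \<phi> y) * (h + y + \<phi> y + 1) = (h\<^sup>2 + h) + ((y\<^sup>2 + y) + (\<phi> y ^ 2 + \<phi> y))"
    by (simp add: expand)
  ultimately have "(h + y + \<phi> y) * (h + y + \<phi> y + 1) = 0"
    by simp
  then have "h = y + \<phi> y \<or> h = y + \<phi> y + 1"
    by (simp add: add_eq_0 add.assoc)
  then have "\<phi> h + h = y + \<phi> (\<phi> y)"
    by (auto simp: add_ac)
  then have "\<phi> (\<phi> y) = y"
    using assms by (metis add_eq_0 add_self)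
  moreover have "\<phi> (\<phi> y) = y + 1"
  proof -
    have "g \<noteq> 0" and "\<phi> (\<phi> g) = 1 / g"
      using gg by (auto simp: eq_divide_eq mult.commute)
    then have "\<phi> (\<phi> y) = (1 / g) / (1 / g + 1)"
      by (simp add: y_def)
    also have "\<dots> = 1 / (g + 1)"
      using g1 \<open>g \<noteq> 0\<close> by (simp add: divide_simps add_ac)
    also have "\<dots> = y + 1"
      using g1 by (simp add: y_def divide_simps add_ac)
    finally show ?thesis .
  qed
  ultimately show False
    by simp
qed

lemma G_neq_G' [simp]: "G \<noteq> G'" "G' \<noteq> G"
proof -
  show "G \<noteq> G'"
    \<comment> \<open>Equality would make the sum of the reciprocals \<open>0\<close>, which
      \<open>h = 0\<close> attains.\<close>
    using not_artin_schreier[of 0] by auto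
  then show "G' \<noteq> G"
    by simp
qed

lemma nrm_coords:
  assumes "\<phi> (\<phi> u) = u" "\<phi> (\<phi> v) = v"
  shows "nrm (u + v * g) = u\<^sup>2 + v\<^sup>2 + u * v * G"
proof -
  have "nrm (u + v * g) = u\<^sup>2 + v\<^sup>2 * nrm g + u * v * G"
    by (simp add: nrm_def trc_def assms expand del: nrm_g)
  then show ?thesis
    by simp
qed

lemma ex_coords: "\<exists>a b. \<phi> (\<phi> a) = a \<and> \<phi> (\<phi> b) = b \<and> d = a + b * g"
proof (intro exI conjI)
  \<comment> \<open>Cramer's rule for \<open>d = a + b * g\<close> and its conjugate equation; the
    determinant is \<open>G\<close>.\<close>
  let ?a = "trc (d * \<phi> (\<phi> g)) / G" and ?b = "trc d / G"
  show "\<phi> (\<phi> ?a) = ?a" "\<phi> (\<phi> ?b) = ?b"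
    by (simp_all only: phi_divide phi_phi_trc)
  have "trc (d * \<phi> (\<phi> g)) + trc d * g = d * G"
    by (simp add: trc_def expand)
  then show "d = ?a + ?b * g"
    by (simp add: eq_divide_eq flip: add_divide_distrib)
qed

end

subsection \<open>The equations for the unit parts\<close>

locale rotation_target = unit_rotation +
  fixes a b :: 'a
  assumes phi_phi_a [simp]: "\<phi> (\<phi> a) = a" and phi_phi_b [simp]: "\<phi> (\<phi> b) = b"
begin

text \<open>The norm of the target \<open>a + b * g\<close>, by \<open>nrm_coords\<close>.\<close>

definition D :: 'a where
  "D = a\<^sup>2 + b\<^sup>2 + a * b * G"

text \<open>\<open>J\<close> and \<open>rhs\<close> arise from cross-multiplying the invariance of
  \<open>(D * u + v * G + \<phi> u) / (G + t)\<close> under \<open>\<phi>\<close>; see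
  \<open>unit_equation_iff\<close>.\<close>

definition J :: "'a \<Rightarrow> 'a" where
  "J t = D * (G' + t) + (G + t)"

definition rhs :: "'a \<Rightarrow> 'a \<Rightarrow> 'a" where
  "rhs u t = u * G * (G' + t) + \<phi> u * G' * (G + t)"

definition sol :: "'a \<Rightarrow> 'a \<Rightarrow> bool" where
  "sol m k \<longleftrightarrow> m * \<phi> m = 1 \<and> k * \<phi> k = 1 \<and>
    J (cross m k) * k + \<phi> (J (cross m k)) * \<phi> k = rhs b (cross m k) \<and>
    J (cross m k) * m + \<phi> (J (cross m k)) * \<phi> m = rhs a (cross m k)"

lemma phi_D: "\<phi> D = (\<phi> a)\<^sup>2 + (\<phi> b)\<^sup>2 + \<phi> a * \<phi> b * G'"
  by (simp add: D_def)

lemma phi_J: "\<phi> t = t \<Longrightarrow> \<phi> (J t) = \<phi> D * (G + t) + (G' + t)"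
  by (simp add: J_def)

lemma gam_neq_0:
  assumes "\<phi> t = t"
  shows "G + t \<noteq> 0" "G' + t \<noteq> 0"
proof -
  show "G + t \<noteq> 0"
    using assms G_neq_G' by (metis add_eq_0)
  then have "\<phi> (G + t) \<noteq> 0"
    by (simp only: phi_eq_0 not_False_eq_True)
  then show "G' + t \<noteq> 0"
    using assms by simp
qed

lemma G'_neq_0: "G' \<noteq> 0"
  by simp

lemma eta_eq: "1 / G + 1 / G' = (G + G') / (G * G')"
  by (simp add: divide_simps add_ac)

text \<open>Otherwise a norm equation and its conjugate would determine the product and the sum of
  two fixed elements, and their \<open>artin_schreier_quotient\<close> would be the root that
  \<open>not_artin_schreier\<close> excludes.\<close>

lemma J_neq_0:
  assumes t: "\<phi> t = t" and wa: "rhs a t = 0" and wb: "rhs b t = 0"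
  shows "J t \<noteq> 0"
proof
  assume "J t = 0"
  then have DJ: "D * (G' + t) = G + t"
    by (simp add: J_def add_eq_0)
  \<comment> \<open>The vanishing of \<open>rhs a t\<close> and \<open>rhs b t\<close> says that
    these multiples of \<open>a\<close> and \<open>b\<close> are fixed by
    \<open>\<phi>\<close>.\<close>
  define u v N where "u = a * G * (G' + t)" and "v = b * G * (G' + t)" and "N = (G + t) * (G' + t)"
  have phi: "\<phi> u = u" "\<phi> v = v" "\<phi> N = N"
    using wa wb t by (simp_all add: u_def v_def N_def rhs_def add_eq_0 mult.commute)
  have "u\<^sup>2 + v\<^sup>2 + u * v * G = (D * (G' + t)) * (G' + t) * G\<^sup>2"
    by (simp add: u_def v_def D_def expand)
  then have 1: "u\<^sup>2 + v\<^sup>2 + u * v * G = N * G\<^sup>2"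
    by (simp only: DJ N_def)
  then have "\<phi> (u\<^sup>2 + v\<^sup>2 + u * v * G) = \<phi> (N * G\<^sup>2)"
    by (rule arg_cong)
  then have 2: "u\<^sup>2 + v\<^sup>2 + u * v * G' = N * G'\<^sup>2"
    by (simp add: phi)
  have "(u\<^sup>2 + v\<^sup>2 + u * v * G) + (u\<^sup>2 + v\<^sup>2 + u * v * G') = N * G\<^sup>2 + N * G'\<^sup>2"
    by (simp only: 1 2)
  then have "(G + G') * (u * v) = (G + G') * (N * (G + G'))"
    by (simp add: expand)
  then have uv: "u * v = N * (G + G')"
    by (simp add: add_eq_0)
  have "(u + v)\<^sup>2 = (u\<^sup>2 + v\<^sup>2 + u * v * G) + u * v * G"
    by (simp add: expand)
  also have "\<dots> = N * (G * G')"
    by (subst 1, subst uv) (simp add: expand)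
  finally have uv2: "(u + v)\<^sup>2 = N * (G * G')" .
  have N: "N \<noteq> 0"
    using gam_neq_0[OF t] by (simp add: N_def)
  then have "u + v \<noteq> 0"
    using uv2 by (metis G_neq_0 G'_neq_0 mult_eq_0_iff zero_eq_power2)
  then have "(u / (u + v))\<^sup>2 + u / (u + v) = 1 / G + 1 / G'"
    unfolding artin_schreier_quotient[OF \<open>u + v \<noteq> 0\<close>] uv uv2 eta_eq using N by simp
  moreover have "\<phi> (u / (u + v)) = u / (u + v)"
    by (simp add: phi)
  ultimately show False
    using not_artin_schreier by blast
qed

lemma sol_J_neq_0:
  assumes "sol m k"
  shows "J (cross m k) \<noteq> 0"
proof
  assume "J (cross m k) = 0"
  moreover from this have "rhs a (cross m k) = 0" "rhs b (cross m k) = 0"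
    using assms by (auto simp: sol_def)
  ultimately show False
    using assms J_neq_0 phi_cross unfolding sol_def by blast
qed

section \<open>The quadratic equation for the cross sum\<close>

lemma sol_quadratic:
  assumes "sol m k" and t: "t = cross m k"
  shows "(1 + D) * (1 + \<phi> D) * t\<^sup>2
       + ((G + G') * (a + \<phi> a + b + \<phi> b)\<^sup>2 + G * G' * (a + \<phi> a) * (b + \<phi> b)) * t
       + G * G' * (a + \<phi> a + b + \<phi> b)\<^sup>2 = 0" (is "?q = 0")
proof -
  have phit: "\<phi> t = t"
    using assms phi_cross by (auto simp: sol_def)
  have "(rhs b t)\<^sup>2 + (rhs a t)\<^sup>2 + rhs b t * rhs a t * t + t\<^sup>2 * (J t * \<phi> (J t)) = 0"
    using assms by (intro conic_resultant[of m "\<phi> m" k "\<phi> k"]) (auto simp: sol_def cross_def)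
  \<comment> \<open>The two linear factors split off by \<open>resultant_factorization\<close> are
    nonzero, because \<open>t\<close> is fixed while \<open>G\<close> is not.\<close>
  then have "(G + t) * (G' + t) * ?q = 0"
    unfolding phi_J[OF phit] unfolding J_def rhs_def phi_D unfolding D_def resultant_factorization .
  then show ?thesis
    using gam_neq_0[OF phit] by simp
qed

text \<open>
  The reciprocals of two distinct values of \<open>cross\<close> would add up to the coefficient quotient of the
  quadratic equation, which is \<open>1 / G + 1 / G'\<close> up to a term \<open>h\<^sup>2 + h\<close>.
\<close>

lemma sol_cross_eq_generic:
  assumes ab: "a + \<phi> a + b + \<phi> b \<noteq> 0" and sol: "sol m k" "sol m' k'"
  shows "cross m k = cross m' k'"
proof (rule ccontr)
  assume neq: "cross m k \<noteq> cross m' k'"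
  define s where "s = (a + \<phi> a) + (b + \<phi> b)"
  have s: "s = a + \<phi> a + b + \<phi> b" "s \<noteq> 0"
    using ab by (simp_all add: s_def add_ac)
  define A B C where "A = (1 + D) * (1 + \<phi> D)"
    and "B = (G + G') * s\<^sup>2 + G * G' * (a + \<phi> a) * (b + \<phi> b)" and "C = G * G' * s\<^sup>2"
  have C: "C \<noteq> 0"
    using s by (simp add: C_def)
  have root: "cross m k \<noteq> 0 \<and> C * (1 / cross m k)\<^sup>2 + B * (1 / cross m k) + A = 0"
    if "sol m k" for m k
  proof -
    let ?t = "cross m k"
    have eq: "A * ?t\<^sup>2 + B * ?t + C = 0"
      using sol_quadratic[OF that refl] by (simp add: A_def B_def C_def s)
    with C have t: "?t \<noteq> 0"
      by auto
    have "C * (1 / ?t)\<^sup>2 + B * (1 / ?t) + A = (A * ?t\<^sup>2 + B * ?t + C) / ?t\<^sup>2"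
      using t by (simp add: add_divide_distrib power2_eq_square add_ac)
    with eq t show ?thesis
      by simp
  qed
  let ?y = "1 / cross m k" and ?y' = "1 / cross m' k'"
  have yy: "?y + ?y' \<noteq> 0"
    using neq root[OF sol(1)] root[OF sol(2)] by (simp add: add_eq_0)
  have "(?y + ?y') * (C * (?y + ?y') + B) = (C * ?y\<^sup>2 + B * ?y + A) + (C * ?y'\<^sup>2 + B * ?y' + A)"
    by (simp add: expand del: times_divide_eq_left times_divide_eq_right)
  also have "\<dots> = 0"
    using root[OF sol(1)] root[OF sol(2)] by simp
  finally have "C * (?y + ?y') = B"
    using yy by (simp add: add_eq_0 del: times_divide_eq_left times_divide_eq_right)
  then have "?y + ?y' = B / C"
    using C by (simp add: eq_divide_eq mult.commute)
  also have "\<dots> = (1 / G + 1 / G') + (a + \<phi> a) * (b + \<phi> b) / s\<^sup>2"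
    unfolding eta_eq B_def C_def using s(2) by (simp add: add_divide_distrib mult_ac)
  \<comment> \<open>This summand is \<open>x * y / (x + y)^2\<close> with fixed \<open>x\<close> and
    \<open>y\<close>, hence \<open>h^2 + h\<close> for a fixed \<open>h\<close>.\<close>
  also have "(a + \<phi> a) * (b + \<phi> b) / s\<^sup>2 = ((a + \<phi> a) / s)\<^sup>2 + (a + \<phi> a) / s"
    unfolding s_def using ab by (intro artin_schreier_quotient[symmetric]) (simp add: add.assoc)
  finally have yy: "?y + ?y' = 1 / G + 1 / G' + ((a + \<phi> a) / s)\<^sup>2 + (a + \<phi> a) / s"
    by (simp add: add.assoc)
  have "\<exists>l. \<phi> l = l + 1 \<and> l\<^sup>2 + l = 1 / cross m k" if "sol m k" for m k
    using that root[OF that] cross_artin_schreier cross_eq_0 unfolding sol_def by blast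
  then obtain l l' where l: "\<phi> l = l + 1" "\<phi> l' = l' + 1" "l\<^sup>2 + l = ?y" "l'\<^sup>2 + l' = ?y'"
    using sol by blast
  have "\<phi> ((a + \<phi> a) / s) = (a + \<phi> a) / s"
    by (simp add: s_def add_ac)
  then show False
    using artin_schreier_mixed[of l l' "1 / G + 1 / G'" "(a + \<phi> a) / s"] l yy not_artin_schreier
    by metis
qed

lemma sol_quadratic_degenerate:
  assumes "a + \<phi> a + b + \<phi> b = 0" "sol m k"
  shows "cross m k * ((1 + D) * (1 + \<phi> D) * cross m k + G * G' * (a + \<phi> a)\<^sup>2) = 0"
proof -
  have "b + \<phi> b = a + \<phi> a"
    using assms(1) by (metis add.assoc add_eq_0)
  then show ?thesis
    using sol_quadratic[OF assms(2) refl] unfolding assms(1) by (simp add: expand)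
qed

text \<open>
  Here the quadratic equation has the root \<open>0\<close>, which forces \<open>m = k\<close>, and \<open>l = J 0 * k / rhs b 0\<close> takes
  the place of an Artin-Schreier root of the reciprocal.
\<close>

lemma sol_cross_neq_0:
  assumes ab: "a + \<phi> a + b + \<phi> b = 0" "a + \<phi> a \<noteq> 0"
    and sol: "sol m k" "sol m' k'" and "cross m k = 0"
  shows "cross m' k' = 0"
proof (rule ccontr)
  assume t: "cross m' k' \<noteq> 0"
  define s c where "s = a + \<phi> a" and "c = a + b"
  have b: "b = a + c" and a': "\<phi> a = a + s"
    by (simp_all add: s_def c_def)
  have "\<phi> c + c = 0"
    using ab(1) by (simp add: c_def add_ac)
  then have c: "\<phi> c = c"
    by (simp only: add_eq_0)
  have s: "\<phi> s = s" "s \<noteq> 0"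
    using ab(2) by (simp_all add: s_def add.commute)
  have b': "\<phi> b = a + s + c"
    by (simp add: b c a')
  have D': "\<phi> D = (a + s)\<^sup>2 + (a + s + c)\<^sup>2 + (a + s) * (a + s + c) * G'"
    unfolding phi_D b' a' ..
  have D: "D = a\<^sup>2 + (a + c)\<^sup>2 + a * (a + c) * G"
    unfolding D_def using b by simp
  define A where "A = (1 + D) * (1 + \<phi> D)"
  define B where "B = G * G' * s\<^sup>2"
  have B: "B \<noteq> 0"
    using s by (simp add: B_def)
  have "cross m' k' * (A * cross m' k' + B) = 0"
    using sol_quadratic_degenerate[OF ab(1) sol(2)] by (simp add: A_def B_def s_def)
  with t have AB: "A * cross m' k' = B"
    by (simp add: add_eq_0)
  with B have t_inv: "1 / cross m' k' = A / B"
    using t by (auto simp: frac_eq_eq)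
  obtain l' where l': "\<phi> l' = l' + 1" "l'\<^sup>2 + l' = 1 / cross m' k'"
    using sol(2) t cross_artin_schreier cross_eq_0 unfolding sol_def by blast
  define H where "H = J 0"
  define i where "i = rhs b 0"
  have H: "H = D * G' + G" "\<phi> H = \<phi> D * G + G'"
    by (simp_all add: H_def J_def)
  have i: "i = G * G' * s"
  proof -
    have "i = G * G' * (b + \<phi> b)"
      by (simp add: i_def rhs_def expand)
    also have "b + \<phi> b = s"
      unfolding b' unfolding b by (simp add: add_ac)
    finally show ?thesis .
  qed
  then have phi_i: "\<phi> i = i" and i0: "i \<noteq> 0"
    using s by (simp_all add: mult_ac)
  have k: "H * k + \<phi> H * \<phi> k = i" "k * \<phi> k = 1"
    using sol(1) assms(5) by (simp_all add: sol_def H_def i_def)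
  \<comment> \<open>Divided by \<open>i\<close>, the two summands of the equation for
    \<open>k\<close> add up to \<open>1\<close> and are exchanged by \<open>\<phi>\<close>.\<close>
  define l where "l = H * k / i"
  have Hk: "H * k + i = \<phi> H * \<phi> k"
    by (simp flip: k(1))
  have "\<phi> l = \<phi> H * \<phi> k / i"
    by (simp add: l_def phi_i)
  also have "\<dots> = l + 1"
    unfolding Hk[symmetric] using i0 by (simp add: l_def add_divide_distrib)
  finally have l: "\<phi> l = l + 1" .
  have "l\<^sup>2 + l = (H * k) * (H * k + i) / i\<^sup>2"
    using i0 by (simp add: l_def power_divide add_divide_distrib power2_eq_square distrib_left)
  also note Hk
  also have "(H * k) * (\<phi> H * \<phi> k) = H * \<phi> H * (k * \<phi> k)"
    by (simp add: mult_ac)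
  finally have ll: "l\<^sup>2 + l = H * \<phi> H / i\<^sup>2"
    by (simp add: k(2))
  \<comment> \<open>Read off from the expanded numerator below: divided by
    \<open>(G * G' * s)^2\<close>, its three terms are \<open>1 / G + 1 / G'\<close>,
    \<open>h^2\<close> and \<open>h\<close>.\<close>
  define h where "h = c * (1 / G + 1 / G') / s"
  have "H * \<phi> H / i\<^sup>2 + A / B = (1 / G + 1 / G') + h\<^sup>2 + h"
  proof -
    have "H * \<phi> H + A * G * G'
      = (G + G') * (G * G') * s\<^sup>2 + c\<^sup>2 * (G + G')\<^sup>2 + c * (G + G') * (G * G') * s"
      unfolding H(2) unfolding H(1) A_def D' unfolding D by (simp add: expand)
    moreover have "H * \<phi> H / i\<^sup>2 + A / B = (H * \<phi> H + A * G * G') / (G * G' * s)\<^sup>2"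
      unfolding i B_def using s(2) by (simp add: add_divide_distrib power2_eq_square)
    moreover have "(1 / G + 1 / G') + h\<^sup>2 + h
      = ((G + G') * (G * G') * s\<^sup>2 + c\<^sup>2 * (G + G')\<^sup>2 + c * (G + G') * (G * G') * s) / (G * G' * s)\<^sup>2"
    proof -
      define e p where "e = 1 / G + 1 / G'" and "p = G * G'"
      have "G + G' = e * p" "p \<noteq> 0"
        by (simp_all add: e_def p_def distrib_right add.commute)
      then show ?thesis
        unfolding h_def e_def[symmetric] p_def[symmetric]
        using s(2) by (simp add: add_divide_distrib power2_eq_square)
    qed
    ultimately show ?thesis
      by simp
  qed
  then have "l\<^sup>2 + l + (l'\<^sup>2 + l') = (1 / G + 1 / G') + h\<^sup>2 + h"
    by (simp only: ll l'(2) t_inv)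
  moreover have "\<phi> h = h"
    by (simp add: h_def c s add.commute)
  ultimately show False
    using artin_schreier_mixed[OF _ l l'(1)] not_artin_schreier by metis
qed

text \<open>The exclusion covers exactly the targets for which all coefficients of the quadratic
  vanish. If the constant term vanishes but \<open>a\<close> is not fixed, the roots are
  \<open>0\<close> and at most one other, and solutions cannot have both.\<close>

lemma sol_cross_eq:
  assumes "\<not> (D = 1 \<and> \<phi> a = a \<and> \<phi> b = b)" and sol: "sol m k" "sol m' k'"
  shows "cross m k = cross m' k'"
proof (cases "a + \<phi> a + b + \<phi> b = 0")
  case False
  then show ?thesis
    using sol by (rule sol_cross_eq_generic)
next
  case sum0: True
  then have bb: "b + \<phi> b = a + \<phi> a"
    by (metis add.assoc add_eq_0)
  have quad: "cross m k * ((1 + D) * (1 + \<phi> D) * cross m k + G * G' * (a + \<phi> a)\<^sup>2) = 0"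
    if "sol m k" for m k
    using sol_quadratic_degenerate[OF sum0 that] .
  show ?thesis
  proof (cases "a + \<phi> a = 0")
    case True
    then have "\<phi> a = a" "\<phi> b = b"
      using bb by (auto simp: add_eq_0)
    with assms(1) have "D \<noteq> 1"
      by blast
    then have "1 + D \<noteq> 0" "1 + \<phi> D \<noteq> 0"
      by (simp_all add: add_eq_0) (metis phi_1 phi_inj)
    then show ?thesis
      using quad[OF sol(1)] quad[OF sol(2)] True by simp
  next
    case False
    have "cross m k = 0 \<longleftrightarrow> cross m' k' = 0"
      using sol_cross_neq_0[OF sum0 False] sol by blast
    moreover have "(1 + D) * (1 + \<phi> D) * cross m k = G * G' * (a + \<phi> a)\<^sup>2"
      if "sol m k" "cross m k \<noteq> 0" for m k
      using quad[OF that(1)] that(2) by (simp add: add_eq_0)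
    moreover have "G * G' * (a + \<phi> a)\<^sup>2 \<noteq> 0"
      using False by simp
    ultimately show ?thesis
      using sol by (metis mult_left_cancel mult_zero_left)
  qed
qed

lemma special_target:
  assumes "D = 1" "\<phi> a = a" "\<phi> b = b"
  shows "a = 1 \<and> b = 0 \<or> a = 0 \<and> b = 1"
proof -
  have 1: "a\<^sup>2 + b\<^sup>2 + a * b * G = 1"
    using assms(1) by (simp add: D_def)
  then have "\<phi> (a\<^sup>2 + b\<^sup>2 + a * b * G) = \<phi> 1"
    by (simp only:)
  then have 2: "a\<^sup>2 + b\<^sup>2 + a * b * G' = 1"
    by (simp add: assms)
  have "a * b * (G + G') = (a\<^sup>2 + b\<^sup>2 + a * b * G) + (a\<^sup>2 + b\<^sup>2 + a * b * G')"
    by (simp add: expand)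
  then have "a * b * (G + G') = 0"
    by (simp only: 1 2 add_self)
  moreover have "G + G' \<noteq> 0"
    using G_neq_G' by (simp only: add_eq_0 not_False_eq_True)
  ultimately have "a = 0 \<or> b = 0"
    by simp
  then show ?thesis
    using 1 power2_inj[of a 1] power2_inj[of b 1] by auto
qed

text \<open>
  In this exceptional case \<open>cross\<close> is not unique, because the quadratic equation vanishes
  identically; the target \<open>d\<close> is \<open>1\<close> or \<open>g\<close>, and \<open>x\<close> itself is still unique.
\<close>

lemma sol_special:
  assumes "D = 1" "\<phi> a = a" "\<phi> b = b" "sol m k"
  shows "a = 1 \<and> b = 0 \<and> k = 1 \<or> a = 0 \<and> b = 1 \<and> m = 1"
proof -
  let ?t = "cross m k"
  have J: "J ?t = G + G'" "\<phi> (J ?t) = G + G'"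
    using assms phi_cross by (simp_all add: J_def sol_def add_ac)
  have *: "u = 1" if "(G + G') * u + (G + G') * \<phi> u = 0" "u * \<phi> u = 1" for u
  proof -
    have "(G + G') * (u + \<phi> u) = 0"
      using that(1) by (simp add: distrib_left)
    then have "\<phi> u = u"
      by (simp add: add_eq_0)
    with that(2) have "u\<^sup>2 = 1\<^sup>2"
      by (simp add: power2_eq_square)
    then show ?thesis
      by (simp only: power2_inj)
  qed
  have eq: "(G + G') * k + (G + G') * \<phi> k = rhs b ?t" "(G + G') * m + (G + G') * \<phi> m = rhs a ?t"
    "m * \<phi> m = 1" "k * \<phi> k = 1"
    using assms(4) unfolding sol_def J by (auto simp: add.commute)
  show ?thesis
    using special_target[OF assms(1-3)]
  proof (elim disjE conjE)
    assume ab: "a = 1" "b = 0"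
    then have "rhs b ?t = 0"
      by (simp add: rhs_def)
    with ab * eq show ?thesis
      by simp
  next
    assume ab: "a = 0" "b = 1"
    then have "rhs a ?t = 0"
      by (simp add: rhs_def)
    with ab * eq show ?thesis
      by simp
  qed
qed

section \<open>Counting the solutions with a common cross sum\<close>

lemma sol_eqI:
  assumes sol: "sol m k" "sol m' k'" and t: "cross m k = t" "cross m' k' = t" "t \<noteq> 0"
    and ratio: "m * \<phi> k = m' * \<phi> k'"
  shows "m = m' \<and> k = k'"
proof -
  define \<kappa> where "\<kappa> = m * \<phi> k"
  have \<kappa>': "\<kappa> = m' * \<phi> k'"
    by (simp add: \<kappa>_def ratio)
  have *: "J t * k * t = rhs a t + \<phi> \<kappa> * rhs b t \<and> m = \<kappa> * k"
    if "sol m k" "cross m k = t" "\<kappa> = m * \<phi> k" for m k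
  proof
    have m: "m * \<phi> m = 1" "k * \<phi> k = 1" "\<phi> (\<phi> k) = k"
      using that phi_phi_unit by (auto simp: sol_def)
    then show mk: "m = \<kappa> * k"
      using that(3) by (simp add: mult.assoc mult.commute[of _ k])
    \<comment> \<open>With \<open>m = \<kappa> * k\<close>, the summands \<open>p\<close> and
      \<open>r\<close> satisfy a linear system of determinant
      \<open>\<kappa> + \<phi> \<kappa> = t\<close>; solving it determines \<open>k\<close>.\<close>
    define p r where "p = J t * k" and "r = \<phi> (J t) * \<phi> k"
    have "t = \<kappa> + \<phi> \<kappa>"
      using that m by (auto simp: cross_def mult_ac)
    then have "p * t = (\<kappa> * p + \<phi> \<kappa> * r) + \<phi> \<kappa> * (p + r)"
      by (simp only:) (simp add: expand)
    also have "\<kappa> * p + \<phi> \<kappa> * r = J t * m + \<phi> (J t) * \<phi> m"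
      by (simp add: p_def r_def mk mult_ac)
    also have "J t * m + \<phi> (J t) * \<phi> m = rhs a t"
      using that by (auto simp: sol_def)
    also have "p + r = rhs b t"
      using that by (auto simp: sol_def p_def r_def)
    finally show "J t * k * t = rhs a t + \<phi> \<kappa> * rhs b t"
      by (simp only: p_def)
  qed
  have "J t * k * t = J t * k' * t"
    using *[OF sol(1) t(1) \<kappa>_def] *[OF sol(2) t(2) \<kappa>'] by simp
  then have "k = k'"
    using t sol_J_neq_0[OF sol(1)] by simp
  then show ?thesis
    using *[OF sol(1) t(1) \<kappa>_def] *[OF sol(2) t(2) \<kappa>'] by simp
qed

text \<open>For \<open>t = 0\<close>, \<open>m = k\<close> is a root of a quadratic with leading
  coefficient \<open>J t\<close>. Otherwise \<open>m / k\<close> is a root of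
  \<open>y^2 + t * y + 1\<close>, and \<open>sol_eqI\<close> recovers the pair from this
  ratio.\<close>

lemma sol_at_most_two:
  assumes sol: "sol m\<^sub>1 k\<^sub>1" "sol m\<^sub>2 k\<^sub>2" "sol m\<^sub>3 k\<^sub>3"
    and t: "cross m\<^sub>1 k\<^sub>1 = t" "cross m\<^sub>2 k\<^sub>2 = t" "cross m\<^sub>3 k\<^sub>3 = t"
  shows "m\<^sub>1 = m\<^sub>2 \<and> k\<^sub>1 = k\<^sub>2 \<or> m\<^sub>1 = m\<^sub>3 \<and> k\<^sub>1 = k\<^sub>3 \<or> m\<^sub>2 = m\<^sub>3 \<and> k\<^sub>2 = k\<^sub>3"
proof (cases "t = 0")
  case True
  have *: "m = k \<and> J t * k\<^sup>2 + rhs b t * k + \<phi> (J t) = 0"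
    if "sol m k" "cross m k = t" for m k
  proof
    show "m = k"
      using that True cross_eq_0 by (auto simp: sol_def)
    have k: "J t * k + \<phi> (J t) * \<phi> k = rhs b t" "k * \<phi> k = 1"
      using that by (auto simp: sol_def)
    have "rhs b t * k = J t * k\<^sup>2 + \<phi> (J t) * (k * \<phi> k)"
      unfolding k(1)[symmetric] by (simp add: expand)
    then show "J t * k\<^sup>2 + rhs b t * k + \<phi> (J t) = 0"
      by (simp add: k(2) add_ac)
  qed
  have "J t \<noteq> 0"
    using sol_J_neq_0[OF sol(1)] t by simp
  then have "k\<^sub>1 = k\<^sub>2 \<or> k\<^sub>1 = k\<^sub>3 \<or> k\<^sub>2 = k\<^sub>3"
    using *[OF sol(1) t(1)] *[OF sol(2) t(2)] *[OF sol(3) t(3)]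
    by (intro quadratic_three_roots[of "J t" k\<^sub>1 "rhs b t" "\<phi> (J t)"]) auto
  then show ?thesis
    using *[OF sol(1) t(1)] *[OF sol(2) t(2)] *[OF sol(3) t(3)] by auto
next
  case False
  have *: "1 * (m * \<phi> k)\<^sup>2 + t * (m * \<phi> k) + 1 = 0" if "sol m k" "cross m k = t" for m k
  proof -
    have m: "m * \<phi> m = 1" "k * \<phi> k = 1"
      using that by (auto simp: sol_def)
    have "t * (m * \<phi> k) = (m * \<phi> k)\<^sup>2 + (m * \<phi> m) * (k * \<phi> k)"
      using that by (simp add: cross_def expand flip: that(2))
    then show ?thesis
      by (simp add: m add_ac)
  qed
  have "m\<^sub>1 * \<phi> k\<^sub>1 = m\<^sub>2 * \<phi> k\<^sub>2 \<or> m\<^sub>1 * \<phi> k\<^sub>1 = m\<^sub>3 * \<phi> k\<^sub>3 \<or> m\<^sub>2 * \<phi> k\<^sub>2 = m\<^sub>3 * \<phi> k\<^sub>3"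
    using *[OF sol(1) t(1)] *[OF sol(2) t(2)] *[OF sol(3) t(3)]
    by (intro quadratic_three_roots[of 1 _ t 1]) auto
  then show ?thesis
    using sol_eqI[OF _ _ _ _ False] sol t by blast
qed

text \<open>
  Passing to \<open>(c / m, c / k)\<close> interchanges the two summands on the left of each equation in \<open>sol\<close>
  and inverts \<open>m / k\<close>.
\<close>

lemma sol_partner:
  assumes "sol m k" and c: "c = \<phi> (J (cross m k)) / J (cross m k)"
  shows "sol (c * \<phi> m) (c * \<phi> k)"
proof -
  let ?t = "cross m k"
  have m: "m * \<phi> m = 1" "k * \<phi> k = 1" "\<phi> (\<phi> k) = k" "\<phi> (\<phi> m) = m"
    using assms phi_phi_unit by (auto simp: sol_def)
  have eq: "J ?t * k + \<phi> (J ?t) * \<phi> k = rhs b ?t" "J ?t * m + \<phi> (J ?t) * \<phi> m = rhs a ?t"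
    using assms by (auto simp: sol_def)
  have J: "J ?t \<noteq> 0" "\<phi> (J ?t) \<noteq> 0"
    using sol_J_neq_0[OF assms(1)] by simp_all
  have phit: "\<phi> ?t = ?t"
    using m phi_cross by simp
  have "\<phi> (\<phi> (J ?t)) = J ?t"
    by (simp add: J_def D_def phit)
  then have c': "\<phi> c = J ?t / \<phi> (J ?t)"
    by (simp add: c)
  have cc: "c * \<phi> c = 1"
    using J unfolding c' by (simp add: c)
  have "cross (c * \<phi> m) (c * \<phi> k) = (c * \<phi> c) * ?t"
    by (simp add: cross_def m expand)
  then have cr: "cross (c * \<phi> m) (c * \<phi> k) = ?t"
    by (simp add: cc)
  have "(c * \<phi> m) * \<phi> (c * \<phi> m) = (c * \<phi> c) * (m * \<phi> m)"
    "(c * \<phi> k) * \<phi> (c * \<phi> k) = (c * \<phi> c) * (k * \<phi> k)"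
    by (simp_all add: m(3,4) mult_ac)
  moreover have "J ?t * c = \<phi> (J ?t)" "\<phi> (J ?t) * \<phi> c = J ?t"
    using J unfolding c' by (simp_all add: c)
  ultimately show ?thesis
    using eq unfolding sol_def cr by (simp add: cc m add.commute flip: mult.assoc)
qed

section \<open>From the norm conditions on \<open>x\<close> and \<open>x + 1\<close> to equations
  for units\<close>

lemma unit_equation_iff:
  assumes u: "u * \<phi> u = 1" and v: "\<phi> (\<phi> v) = v" and t: "\<phi> t = t"
  shows "J t * u + \<phi> (J t) * \<phi> u = rhs v t \<longleftrightarrow>
    (\<exists>\<alpha>. \<phi> \<alpha> = \<alpha> \<and> D * u + v * G + \<phi> u = \<alpha> * (G + t))"
proof -
  define z where "z = D * u + v * G + \<phi> u"
  have z': "\<phi> z = \<phi> D * \<phi> u + \<phi> v * G' + u"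
    by (simp add: z_def phi_phi_unit[OF u])
  have sum: "J t * u + \<phi> (J t) * \<phi> u + rhs v t = z * (G' + t) + \<phi> z * (G + t)"
    unfolding phi_J[OF t] z' unfolding J_def z_def rhs_def by (simp add: expand)
  have "J t * u + \<phi> (J t) * \<phi> u = rhs v t \<longleftrightarrow> z * (G' + t) = \<phi> z * (G + t)"
    by (subst (1 2) add_eq_0[symmetric]) (simp only: sum)
  also have "\<dots> \<longleftrightarrow> \<phi> z * (G + t) = z * (G' + t)"
    by (rule eq_commute)
  \<comment> \<open>The witness \<open>\<alpha>\<close> is forced to be \<open>z / (G + t)\<close>,
    so its existence amounts to the invariance of this quotient.\<close>
  also have "\<dots> \<longleftrightarrow> \<phi> (z / (G + t)) = z / (G + t)"
    using gam_neq_0[OF t] by (simp add: t frac_eq_eq)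
  also have "\<dots> \<longleftrightarrow> (\<exists>\<alpha>. \<alpha> = z / (G + t) \<and> \<phi> \<alpha> = \<alpha>)"
    by (simp only: simp_thms)
  also have "\<dots> \<longleftrightarrow> (\<exists>\<alpha>. \<phi> \<alpha> = \<alpha> \<and> z = \<alpha> * (G + t))"
  proof -
    have "\<alpha> = z / (G + t) \<longleftrightarrow> z = \<alpha> * (G + t)" for \<alpha>
      using gam_neq_0(1)[OF t] by (auto simp: eq_divide_eq)
    then show ?thesis
      by (simp only: conj_commute)
  qed
  finally show ?thesis
    unfolding z_def .
qed

lemma linear_iff:
  "(x + 1) * \<phi> k + g * x * \<phi> m = a + b * g \<longleftrightarrow> x * (\<phi> k + g * \<phi> m) = a + b * g + \<phi> k"
  "(x + 1) * \<phi> k + g * x * \<phi> m = a + b * g \<longleftrightarrow> (x + 1) * (\<phi> k + g * \<phi> m) = a + b * g + g * \<phi> m"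
proof -
  have "x * (\<phi> k + g * \<phi> m) = (x + 1) * \<phi> k + g * x * \<phi> m + \<phi> k"
    "(x + 1) * (\<phi> k + g * \<phi> m) = (x + 1) * \<phi> k + g * x * \<phi> m + g * \<phi> m"
    by (simp_all add: expand)
  then show "(x + 1) * \<phi> k + g * x * \<phi> m = a + b * g \<longleftrightarrow> x * (\<phi> k + g * \<phi> m) = a + b * g + \<phi> k"
    "(x + 1) * \<phi> k + g * x * \<phi> m = a + b * g \<longleftrightarrow> (x + 1) * (\<phi> k + g * \<phi> m) = a + b * g + g * \<phi> m"
    by (simp_all only: add_right_cancel)
qed

text \<open>
  As \<open>m\<close> and \<open>k\<close> are units, this is \<open>(x + 1) / k + g * x / m = a + b * g\<close>. For \<open>x = 0\<close> every unit \<open>m\<close> is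
  allowed, likewise every \<open>k\<close> for \<open>x = 1\<close>.
\<close>

definition rep :: "'a \<Rightarrow> 'a \<Rightarrow> 'a \<Rightarrow> bool" where
  "rep x m k \<longleftrightarrow> m * \<phi> m = 1 \<and> k * \<phi> k = 1 \<and>
    (\<exists>\<alpha>. \<phi> \<alpha> = \<alpha> \<and> nrm x = \<alpha> * m) \<and> (\<exists>\<beta>. \<phi> \<beta> = \<beta> \<and> nrm (x + 1) = \<beta> * k) \<and>
    (x + 1) * \<phi> k + g * x * \<phi> m = a + b * g"

context
  fixes m k :: 'a
  assumes m: "m * \<phi> m = 1" and k: "k * \<phi> k = 1"
begin

text \<open>The coordinates \<open>\<phi> k\<close> and \<open>\<phi> m\<close> are inverses of
  units; factoring them out of the norm form is what brings \<open>cross m k\<close> into the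
  equations.\<close>

lemma nrm_denominator: "nrm (\<phi> k + g * \<phi> m) = \<phi> m * \<phi> k * (G + cross m k)"
proof -
  note mk = phi_phi_unit[OF m] phi_phi_unit[OF k]
  have "nrm (\<phi> k + g * \<phi> m) = (\<phi> k)\<^sup>2 + (\<phi> m)\<^sup>2 + \<phi> k * \<phi> m * G"
    using nrm_coords[of "\<phi> k" "\<phi> m"] by (simp add: mk mult.commute)
  also have "\<dots> = (\<phi> k)\<^sup>2 * (m * \<phi> m) + (\<phi> m)\<^sup>2 * (k * \<phi> k) + \<phi> m * \<phi> k * G"
    by (simp add: m k mult.commute)
  also have "\<dots> = \<phi> m * \<phi> k * (G + cross m k)"
    by (simp add: cross_def expand)
  finally show ?thesis .
qed

lemma denominator_neq_0: "\<phi> k + g * \<phi> m \<noteq> 0"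
proof -
  have "\<phi> m * \<phi> k * (G + cross m k) \<noteq> 0"
    using m k gam_neq_0[OF phi_cross[OF m k]] by auto
  then show ?thesis
    unfolding nrm_denominator[symmetric] by (simp only: nrm_eq_0 not_False_eq_True)
qed

lemma nrm_numerators:
  "nrm (a + b * g + \<phi> k) = \<phi> k * (D * k + b * G + \<phi> k)"
  "nrm (a + b * g + g * \<phi> m) = \<phi> m * (D * m + a * G + \<phi> m)"
proof -
  note mk = phi_phi_unit[OF m] phi_phi_unit[OF k]
  have "nrm (a + b * g + \<phi> k) = D + b * G * \<phi> k + (\<phi> k)\<^sup>2"
    using nrm_coords[of "a + \<phi> k" b] by (simp add: mk D_def add_ac) (simp add: expand)
  also have "\<dots> = D * (k * \<phi> k) + b * G * \<phi> k + (\<phi> k)\<^sup>2"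
    by (simp add: k)
  finally show "nrm (a + b * g + \<phi> k) = \<phi> k * (D * k + b * G + \<phi> k)"
    by (simp add: expand)
  have "nrm (a + b * g + g * \<phi> m) = D + a * G * \<phi> m + (\<phi> m)\<^sup>2"
    using nrm_coords[of a "b + \<phi> m"]
    by (simp add: mk D_def distrib_right add_ac mult.commute[of g]) (simp add: expand)
  also have "\<dots> = D * (m * \<phi> m) + a * G * \<phi> m + (\<phi> m)\<^sup>2"
    by (simp add: m)
  finally show "nrm (a + b * g + g * \<phi> m) = \<phi> m * (D * m + a * G + \<phi> m)"
    by (simp add: expand)
qed

end

text \<open>Taking norms in the two forms of \<open>linear_iff\<close> crosses the roles: the
  condition on \<open>x\<close> becomes the equation for \<open>k\<close>, and that on
  \<open>x + 1\<close> the equation for \<open>m\<close>.\<close>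

lemma rep_iff: "rep x m k \<longleftrightarrow> sol m k \<and> x * (\<phi> k + g * \<phi> m) = a + b * g + \<phi> k"
proof (cases "m * \<phi> m = 1 \<and> k * \<phi> k = 1 \<and> x * (\<phi> k + g * \<phi> m) = a + b * g + \<phi> k")
  case True
  then have m: "m * \<phi> m = 1" and k: "k * \<phi> k = 1"
    and lin: "x * (\<phi> k + g * \<phi> m) = a + b * g + \<phi> k"
    by auto
  note lins = linear_iff[of x k m]
  let ?e = "G + cross m k"
  have t: "\<phi> (cross m k) = cross m k"
    using phi_cross[OF m k] .
  have nz: "\<phi> m \<noteq> 0" "\<phi> k \<noteq> 0" "?e \<noteq> 0"
    using m k gam_neq_0[OF t] by auto
  have "nrm x * nrm (\<phi> k + g * \<phi> m) = nrm (a + b * g + \<phi> k)"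
    by (simp only: lin flip: nrm_mult)
  then have "nrm x * (\<phi> m * \<phi> k * ?e) = \<phi> k * (D * k + b * G + \<phi> k)"
    unfolding nrm_denominator[OF m k] nrm_numerators[OF m k] .
  then have 1: "nrm x = \<alpha> * m \<longleftrightarrow> D * k + b * G + \<phi> k = \<alpha> * ?e" for \<alpha>
    using m nz by (intro nrm_eq_iff) auto
  have "(x + 1) * (\<phi> k + g * \<phi> m) = a + b * g + g * \<phi> m"
    using lin lins by blast
  then have "nrm (x + 1) * nrm (\<phi> k + g * \<phi> m) = nrm (a + b * g + g * \<phi> m)"
    by (simp only: flip: nrm_mult)
  then have "nrm (x + 1) * (\<phi> k * \<phi> m * ?e) = \<phi> m * (D * m + a * G + \<phi> m)"
    unfolding nrm_denominator[OF m k] nrm_numerators[OF m k] by (simp only: mult.commute[of "\<phi> m" "\<phi> k"])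
  then have 2: "nrm (x + 1) = \<beta> * k \<longleftrightarrow> D * m + a * G + \<phi> m = \<beta> * ?e" for \<beta>
    using k nz by (intro nrm_eq_iff) auto
  show ?thesis
    unfolding rep_def sol_def unit_equation_iff[OF k phi_phi_b t] unit_equation_iff[OF m phi_phi_a t] 1 2
    by (simp add: m k lin lins(1))
next
  case False
  show ?thesis
  proof
    assume "rep x m k"
    then have "m * \<phi> m = 1 \<and> k * \<phi> k = 1 \<and> x * (\<phi> k + g * \<phi> m) = a + b * g + \<phi> k"
      unfolding rep_def linear_iff(1) by (elim conjE) (intro conjI)
    with False show "sol m k \<and> x * (\<phi> k + g * \<phi> m) = a + b * g + \<phi> k" ..
  next
    assume "sol m k \<and> x * (\<phi> k + g * \<phi> m) = a + b * g + \<phi> k"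
    then have "m * \<phi> m = 1 \<and> k * \<phi> k = 1 \<and> x * (\<phi> k + g * \<phi> m) = a + b * g + \<phi> k"
      unfolding sol_def by (elim conjE) (intro conjI)
    with False show "rep x m k" ..
  qed
qed

lemma rep_at_most_two:
  assumes rep: "rep x\<^sub>1 m\<^sub>1 k\<^sub>1" "rep x\<^sub>2 m\<^sub>2 k\<^sub>2" "rep x\<^sub>3 m\<^sub>3 k\<^sub>3"
  shows "x\<^sub>1 = x\<^sub>2 \<or> x\<^sub>1 = x\<^sub>3 \<or> x\<^sub>2 = x\<^sub>3"
proof (cases "D = 1 \<and> \<phi> a = a \<and> \<phi> b = b")
  case True
  \<comment> \<open>In the exceptional case the numerator of \<open>x\<close> or that of
    \<open>x + 1\<close> is \<open>0\<close>, so \<open>x\<close> does not depend on the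
    units.\<close>
  have *: "x = a + 1 \<and> (a = 0 \<or> a = 1)" if "rep x m k" for x m k
  proof -
    have sol: "sol m k" and x: "(x + 1) * \<phi> k + g * x * \<phi> m = a + b * g"
      using that by (simp_all only: rep_iff linear_iff(1))
    have "\<phi> k + g * \<phi> m \<noteq> 0" and "x * (\<phi> k + g * \<phi> m) = a + b * g + \<phi> k" "(x + 1) * (\<phi> k + g * \<phi> m) = a + b * g + g * \<phi> m"
      using sol x denominator_neq_0 linear_iff[of x k m] unfolding sol_def by auto
    moreover have "a = 1 \<and> b = 0 \<and> k = 1 \<or> a = 0 \<and> b = 1 \<and> m = 1"
      using sol_special[OF _ _ _ sol] True by blast
    ultimately show ?thesis
      by (elim disjE conjE) (simp_all add: add_eq_0)
  qed
  show ?thesis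
    using *[OF rep(1)] *[OF rep(2)] by simp
next
  case False
  have det: "x = y" if "rep x m k" "rep y m k" for x y m k
  proof -
    have "m * \<phi> m = 1" "k * \<phi> k = 1"
      using that(1) by (simp_all add: rep_def)
    then have "\<phi> k + g * \<phi> m \<noteq> 0"
      by (rule denominator_neq_0)
    moreover have "x * (\<phi> k + g * \<phi> m) = y * (\<phi> k + g * \<phi> m)"
      using that unfolding rep_iff by simp
    ultimately show ?thesis
      by simp
  qed
  have sol: "sol m\<^sub>1 k\<^sub>1" "sol m\<^sub>2 k\<^sub>2" "sol m\<^sub>3 k\<^sub>3"
    using rep by (simp_all add: rep_iff)
  have "m\<^sub>1 = m\<^sub>2 \<and> k\<^sub>1 = k\<^sub>2 \<or> m\<^sub>1 = m\<^sub>3 \<and> k\<^sub>1 = k\<^sub>3 \<or> m\<^sub>2 = m\<^sub>3 \<and> k\<^sub>2 = k\<^sub>3"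
    by (rule sol_at_most_two[OF sol refl sol_cross_eq[OF False sol(2,1)] sol_cross_eq[OF False sol(3,1)]])
  then show ?thesis
  proof (elim disjE conjE)
    assume "m\<^sub>1 = m\<^sub>2" "k\<^sub>1 = k\<^sub>2"
    with rep(1) have "rep x\<^sub>1 m\<^sub>2 k\<^sub>2" by simp
    from det[OF this rep(2)] show ?thesis by (rule disjI1)
  next
    assume "m\<^sub>1 = m\<^sub>3" "k\<^sub>1 = k\<^sub>3"
    with rep(1) have "rep x\<^sub>1 m\<^sub>3 k\<^sub>3" by simp
    from det[OF this rep(3)] show ?thesis by simp
  next
    assume "m\<^sub>2 = m\<^sub>3" "k\<^sub>2 = k\<^sub>3"
    with rep(2) have "rep x\<^sub>2 m\<^sub>3 k\<^sub>3" by simp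
    from det[OF this rep(3)] show ?thesis by simp
  qed
qed

text \<open>If the partner belonged to the same \<open>x\<close>, comparing coordinates with respect
  to \<open>1\<close> and \<open>g\<close>, possible as \<open>x\<close> is fixed by
  \<open>\<phi> \<circ> \<phi>\<close>, would make \<open>m\<close> and \<open>k\<close> invariant
  under the involution; then \<open>m^2 = c = k^2\<close>.\<close>

lemma rep_partner:
  assumes rep: "rep x m k" and "m \<noteq> k" and x: "\<phi> (\<phi> x) = x" "x \<noteq> 0" "x \<noteq> 1"
  shows "\<exists>x' m' k'. x' \<noteq> x \<and> rep x' m' k'"
proof -
  define c where "c = \<phi> (J (cross m k)) / J (cross m k)"
  let ?m = "c * \<phi> m" and ?k = "c * \<phi> k"
  have units: "m * \<phi> m = 1" "k * \<phi> k = 1" and sol: "sol m k"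
    using rep by (simp_all only: rep_iff) (simp_all only: sol_def)
  have sol': "sol ?m ?k"
    using sol_partner[OF sol c_def] .
  then have units': "?m * \<phi> ?m = 1" "?k * \<phi> ?k = 1"
    by (simp_all only: sol_def)
  define x' where "x' = (a + b * g + \<phi> ?k) / (\<phi> ?k + g * \<phi> ?m)"
  have rep': "rep x' ?m ?k"
    using sol' denominator_neq_0[OF units'] unfolding rep_iff x'_def by simp
  have "x' \<noteq> x"
  proof
    assume "x' = x"
    then have eq: "(x + 1) * \<phi> k + g * x * \<phi> m = (x + 1) * \<phi> ?k + g * x * \<phi> ?m"
      using rep rep' unfolding rep_def by metis
    define u v where "u = (x + 1) * (\<phi> k + \<phi> ?k)" and "v = x * (\<phi> m + \<phi> ?m)"
    have "u + v * g = ((x + 1) * \<phi> k + g * x * \<phi> m) + ((x + 1) * \<phi> ?k + g * x * \<phi> ?m)"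
      by (simp add: u_def v_def expand)
    then have uv: "u + v * g = 0"
      unfolding eq add_self .
    have "\<phi> (\<phi> u) = u" "\<phi> (\<phi> v) = v"
      using phi_phi_unit[OF units(1)] phi_phi_unit[OF units(2)] phi_phi_unit[OF units'(1)] phi_phi_unit[OF units'(2)]
      by (simp_all add: u_def v_def x)
    then have "u + v * \<phi> (\<phi> g) = \<phi> (\<phi> (u + v * g))"
      by simp
    then have "u + v * \<phi> (\<phi> g) = u + v * g"
      by (simp add: uv)
    then have "v * \<phi> (\<phi> g) = v * g"
      by (simp only: add_left_cancel)
    then have "v * G = 0"
      by (simp only: trc_def distrib_left add_self)
    then have "v = 0"
      by simp
    with uv have "u = 0"
      by simp
    with \<open>v = 0\<close> x have "\<phi> k = \<phi> ?k" "\<phi> m = \<phi> ?m"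
      unfolding u_def v_def by (simp_all only: mult_eq_0_iff add_eq_0 simp_thms)
    then have "k = c * \<phi> k" "m = c * \<phi> m"
      by (simp_all only: phi_inj)
    moreover have "z\<^sup>2 = c * (z * \<phi> z)" if "z = c * \<phi> z" for z
    proof -
      have "z\<^sup>2 = z * (c * \<phi> z)"
        by (simp only: power2_eq_square that[symmetric])
      then show ?thesis
        by (simp only: mult.left_commute)
    qed
    ultimately have "k\<^sup>2 = m\<^sup>2"
      by (simp only: units)
    with \<open>m \<noteq> k\<close> show False
      by (simp add: power2_inj)
  qed
  then show ?thesis
    using rep' by (intro exI conjI)
qed

end

subsection \<open>The power function\<close>

locale norm_quotient = quartic_frobenius +
  fixes F :: "'a \<Rightarrow> 'a"
  assumes F_0 [simp]: "F 0 = 0"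
    and F_mult_square: "F x * x\<^sup>2 = nrm x * \<phi> (nrm x)"
begin

text \<open>The product of the four conjugates of \<open>x\<close> is \<open>\<alpha>^2\<close>, so
  \<open>F x = (\<alpha> / x)^2\<close> for nonzero \<open>x\<close>, and
  \<open>\<alpha> / x\<close> is \<open>\<phi> (\<phi> x) / m\<close>.\<close>

lemma F_eq:
  assumes m: "m * \<phi> m = 1" and \<alpha>: "\<phi> \<alpha> = \<alpha>" and x: "nrm x = \<alpha> * m"
  shows "F x = (\<phi> (\<phi> x) * \<phi> m)\<^sup>2"
proof (cases "x = 0")
  case False
  have "F x * x\<^sup>2 = \<alpha>\<^sup>2 * (m * \<phi> m)"
    unfolding F_mult_square x by (simp add: \<alpha> power2_eq_square mult_ac)
  moreover have "(\<phi> (\<phi> x) * \<phi> m)\<^sup>2 * x\<^sup>2 = (nrm x * \<phi> m)\<^sup>2"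
    by (simp add: nrm_def power_mult_distrib mult_ac)
  moreover have "nrm x * \<phi> m = \<alpha> * (m * \<phi> m)"
    by (simp add: x mult_ac)
  ultimately have "F x * x\<^sup>2 = (\<phi> (\<phi> x) * \<phi> m)\<^sup>2 * x\<^sup>2"
    by (simp only: m mult_1_right)
  with False show ?thesis
    by simp
qed simp

lemma ex_unit: "\<exists>m. m * \<phi> m = 1 \<and> (\<exists>\<alpha>. \<phi> \<alpha> = \<alpha> \<and> nrm x = \<alpha> * m)"
proof (cases "x = 0")
  case True
  then show ?thesis
    by (intro exI[of _ 1] conjI exI[of _ 0]) simp_all
next
  case False
  define n where "n = nrm x"
  have n: "n \<noteq> 0" "\<phi> (\<phi> n) = n"
    using False by (simp_all add: n_def)
  \<comment> \<open>This square is forced: \<open>n = \<alpha> * m\<close> with fixed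
    \<open>\<alpha>\<close> gives \<open>n / \<phi> n = m / \<phi> m = m^2\<close>.\<close>
  obtain m where m: "m\<^sup>2 = n / \<phi> n"
    using ex_sqrt by blast
  have "(m * \<phi> m)\<^sup>2 = m\<^sup>2 * \<phi> (m\<^sup>2)"
    by (simp add: power_mult_distrib)
  also have "\<dots> = 1\<^sup>2"
    unfolding m using n by simp
  finally have mm: "m * \<phi> m = 1"
    by (simp only: power2_inj)
  have "(\<phi> (n / m))\<^sup>2 = \<phi> (n\<^sup>2 / m\<^sup>2)"
    by (simp add: power_divide)
  also have "\<dots> = (n / m)\<^sup>2"
    unfolding power_divide m using n by (simp add: power2_eq_square)
  finally have "\<phi> (n / m) = n / m"
    by (simp only: power2_inj)
  moreover have "nrm x = n / m * m"
    using mm by (auto simp: n_def)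
  ultimately show ?thesis
    using mm by blast
qed

lemma deriv_eq_iff:
  assumes "m * \<phi> m = 1" "\<phi> \<alpha> = \<alpha>" "nrm x = \<alpha> * m"
    and "k * \<phi> k = 1" "\<phi> \<beta> = \<beta>" "nrm (x + 1) = \<beta> * k"
  shows "F (x + 1) + (\<phi> (\<phi> g))\<^sup>2 * F x = (\<phi> (\<phi> d))\<^sup>2 \<longleftrightarrow> (x + 1) * \<phi> k + g * x * \<phi> m = d"
proof -
  have "F (x + 1) + (\<phi> (\<phi> g))\<^sup>2 * F x = (\<phi> (\<phi> (x + 1)) * \<phi> k)\<^sup>2 + (\<phi> (\<phi> g) * (\<phi> (\<phi> x) * \<phi> m))\<^sup>2"
    using F_eq[OF assms(1-3)] F_eq[OF assms(4-6)] by (simp only: power_mult_distrib)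
  also have "\<dots> = (\<phi> (\<phi> ((x + 1) * \<phi> k + g * x * \<phi> m)))\<^sup>2"
    unfolding power2_add[symmetric]
    by (simp add: phi_phi_unit[OF assms(1)] phi_phi_unit[OF assms(4)] mult_ac)
  finally show ?thesis
    by (simp only: power2_inj phi_inj)
qed

lemma ex_rotation:
  assumes "nrm c = 1" "c \<noteq> 1"
  obtains g where "c = (\<phi> (\<phi> g))\<^sup>2" "unit_rotation \<phi> g"
proof -
  obtain r where r: "r\<^sup>2 = c"
    using ex_sqrt by blast
  have "(nrm r)\<^sup>2 = 1\<^sup>2"
    using assms(1) by (simp add: nrm_mult power2_eq_square flip: r)
  then have "nrm r = 1"
    by (simp only: power2_inj)
  then have "nrm (\<phi> (\<phi> r)) = 1"
    by (simp add: nrm_def mult.commute)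
  moreover have "\<phi> (\<phi> r) \<noteq> 1"
    using assms(2) r by (metis phi_1 phi_inj power_one)
  ultimately have "unit_rotation \<phi> (\<phi> (\<phi> r))"
    by unfold_locales
  with r show thesis
    by (intro that[of "\<phi> (\<phi> r)"]) simp_all
qed

lemma ex_target:
  assumes "unit_rotation \<phi> g"
  obtains a b where "\<beta> = (\<phi> (\<phi> (a + b * g)))\<^sup>2" "rotation_target \<phi> g a b"
proof -
  interpret unit_rotation \<phi> g
    by fact
  obtain d where d: "d\<^sup>2 = \<beta>"
    using ex_sqrt by blast
  obtain a b where ab: "\<phi> (\<phi> a) = a" "\<phi> (\<phi> b) = b" "\<phi> (\<phi> d) = a + b * g"
    using ex_coords by blast
  then have "rotation_target \<phi> g a b"
    by unfold_locales
  moreover have "\<beta> = (\<phi> (\<phi> (a + b * g)))\<^sup>2"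
    by (simp add: d flip: ab(3))
  ultimately show thesis
    by (intro that)
qed

lemma deriv_eq_iff_rep:
  assumes "rotation_target \<phi> g a b"
  shows "F (x + 1) + (\<phi> (\<phi> g))\<^sup>2 * F x = (\<phi> (\<phi> (a + b * g)))\<^sup>2
    \<longleftrightarrow> (\<exists>m k. rotation_target.rep \<phi> g a b x m k)"
proof -
  interpret rotation_target \<phi> g a b
    by fact
  show ?thesis
  proof
    assume eq: "F (x + 1) + (\<phi> (\<phi> g))\<^sup>2 * F x = (\<phi> (\<phi> (a + b * g)))\<^sup>2"
    obtain m \<alpha> where m: "m * \<phi> m = 1" "\<phi> \<alpha> = \<alpha>" "nrm x = \<alpha> * m"
      using ex_unit by blast
    obtain k \<beta> where k: "k * \<phi> k = 1" "\<phi> \<beta> = \<beta>" "nrm (x + 1) = \<beta> * k"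
      using ex_unit by blast
    have "rep x m k"
      unfolding rep_def using m k deriv_eq_iff[OF m k, of g "a + b * g"] eq by blast
    then show "\<exists>m k. rep x m k"
      by blast
  next
    assume "\<exists>m k. rep x m k"
    then obtain m k where "rep x m k"
      by blast
    then show "F (x + 1) + (\<phi> (\<phi> g))\<^sup>2 * F x = (\<phi> (\<phi> (a + b * g)))\<^sup>2"
      unfolding rep_def using deriv_eq_iff by blast
  qed
qed

lemma deriv_at_most_two:
  assumes "nrm c = 1" "c \<noteq> 1"
    and "F (x + 1) + c * F x = \<beta>" "F (y + 1) + c * F y = \<beta>" "F (z + 1) + c * F z = \<beta>"
  shows "x = y \<or> x = z \<or> y = z"
proof -
  obtain g where g: "c = (\<phi> (\<phi> g))\<^sup>2" "unit_rotation \<phi> g"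
    using assms(1,2) by (rule ex_rotation)
  obtain a b where ab: "\<beta> = (\<phi> (\<phi> (a + b * g)))\<^sup>2" "rotation_target \<phi> g a b"
    using g(2) by (rule ex_target)
  show ?thesis
    using assms(3-5) rotation_target.rep_at_most_two[OF ab(2)]
    unfolding g(1) ab(1) deriv_eq_iff_rep[OF ab(2)] by (elim exE)
qed

lemma deriv_two:
  assumes "nrm c = 1" "c \<noteq> 1"
  shows "\<exists>x y. x \<noteq> y \<and> F (x + 1) + c * F x = F (y + 1) + c * F y"
proof -
  obtain g where g: "c = (\<phi> (\<phi> g))\<^sup>2" "unit_rotation \<phi> g"
    using assms by (rule ex_rotation)
  then interpret unit_rotation \<phi> g
    by blast
  \<comment> \<open>\<open>G\<close> is fixed by \<open>\<phi> \<circ> \<phi>\<close>, as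
    \<open>rep_partner\<close> requires, but not by \<open>\<phi>\<close>, which forces distinct
    units.\<close>
  define \<beta> where "\<beta> = F (G + 1) + c * F G"
  obtain a b where ab: "\<beta> = (\<phi> (\<phi> (a + b * g)))\<^sup>2" "rotation_target \<phi> g a b"
    using g(2) by (rule ex_target)
  interpret rotation_target \<phi> g a b
    by fact
  note iff = deriv_eq_iff_rep[OF ab(2), folded ab(1) g(1)]
  obtain m k where rep: "rep G m k"
    using iff[of G] by (auto simp: \<beta>_def)
  have G1: "G \<noteq> 1"
    using G_neq_G'(1) by (metis phi_1)
  \<comment> \<open>Equal units would make \<open>nrm G / nrm (G + 1)\<close>, the square of
    \<open>G / (G + 1)\<close>, fixed by \<open>\<phi>\<close>, and then \<open>G\<close> as
    well.\<close>
  have "m \<noteq> k"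
  proof
    assume "m = k"
    then obtain \<alpha> \<gamma> where \<alpha>: "\<phi> \<alpha> = \<alpha>" "nrm G = \<alpha> * k" and \<gamma>: "\<phi> \<gamma> = \<gamma>" "nrm (G + 1) = \<gamma> * k"
      using rep unfolding rep_def by blast
    have nrm: "nrm G = G\<^sup>2" "nrm (G + 1) = (G + 1)\<^sup>2"
      by (simp_all add: nrm_def power2_eq_square)
    then have nz: "\<alpha> \<noteq> 0" "\<gamma> \<noteq> 0"
      using \<alpha>(2) \<gamma>(2) G1 by (auto simp: add_eq_0)
    have 1: "G\<^sup>2 * \<gamma> = (G + 1)\<^sup>2 * \<alpha>"
      unfolding nrm[symmetric] \<alpha>(2) \<gamma>(2) by (simp add: mult_ac)
    then have "\<phi> (G\<^sup>2 * \<gamma>) = \<phi> ((G + 1)\<^sup>2 * \<alpha>)"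
      by (rule arg_cong)
    then have 2: "G'\<^sup>2 * \<gamma> = (G' + 1)\<^sup>2 * \<alpha>"
      by (simp add: \<alpha>(1) \<gamma>(1))
    have "(G * (G' + 1))\<^sup>2 * (\<alpha> * \<gamma>) = (G\<^sup>2 * \<gamma>) * ((G' + 1)\<^sup>2 * \<alpha>)"
      by (simp only: power_mult_distrib mult_ac)
    also have "\<dots> = ((G + 1) * G')\<^sup>2 * (\<alpha> * \<gamma>)"
      unfolding 1 2[symmetric] by (simp only: power_mult_distrib mult_ac)
    finally have "(G * (G' + 1))\<^sup>2 = ((G + 1) * G')\<^sup>2"
      using nz by simp
    then have "G * (G' + 1) = (G + 1) * G'"
      by (simp only: power2_inj)
    then have "G = G'"
      by (simp add: distrib_left distrib_right)
    then show False
      using G_neq_G'(1) by blast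
  qed
  then obtain y m' k' where y: "y \<noteq> G" "rep y m' k'"
    using rep_partner[OF rep _ phi_phi_trc G_neq_0 G1] by blast
  then have "F (y + 1) + c * F y = \<beta>"
    using iff by blast
  with y(1) show ?thesis
    unfolding \<beta>_def by blast
qed

text \<open>As \<open>\<phi>\<close> fixes the product \<open>p\<close> of the conjugates of
  \<open>x\<close>, the same product for \<open>F x = p / x^2\<close> is
  \<open>p^4 / p^2 = p^2\<close>; dividing it by \<open>(F x)^2\<close> leaves
  \<open>x^4\<close>.\<close>

lemma F_F: "F (F x) = x ^ 4"
proof (cases "x = 0")
  case False
  define p f where "p = nrm x * \<phi> (nrm x)" and "f = F x"
  have p: "\<phi> p = p" "p \<noteq> 0"
    using False by (simp_all add: p_def mult.commute)
  have f: "f = p / x\<^sup>2"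
    using F_mult_square[of x] False by (simp add: p_def f_def eq_divide_eq)
  have "nrm f * \<phi> (nrm f) = (nrm p * \<phi> (nrm p)) / (nrm x * \<phi> (nrm x))\<^sup>2"
    unfolding f by (simp add: nrm_divide nrm_mult power2_eq_square mult_ac)
  also have "\<dots> = p\<^sup>2"
    using p by (simp add: nrm_def[of p] flip: p_def) (simp add: power2_eq_square)
  finally have "F f * f\<^sup>2 = p\<^sup>2"
    by (simp only: F_mult_square)
  then show ?thesis
    using False p by (simp add: f f_def[symmetric] power_divide field_simps flip: power_mult)
qed simp

lemma inj_F: "inj F"
proof (rule injI)
  fix x y assume "F x = F y"
  then have "x ^ 4 = y ^ 4"
    by (metis F_F)
  then have "(x\<^sup>2)\<^sup>2 = (y\<^sup>2)\<^sup>2"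
    by (simp flip: power_mult)
  then show "x = y"
    by (simp only: power2_inj)
qed

end

section \<open>Specialization to the field with \<open>q^4\<close> elements\<close>

theorem theorem1:
  fixes n q :: nat and F :: "'a::{field,finite} \<Rightarrow> 'a"
  assumes "n \<ge> 1"
    and "q = 2 ^ n"
    and "CARD('a) = q ^ 4"
    and "F = (\<lambda>x. x ^ (q ^ 3 + q ^ 2 + q - 1))"
  shows "bij F \<and> (\<forall>c \<in> mu (q ^ 2 + 1) - {1}. APcN c F)"
proof -
  have "even q" "q \<ge> 1"
    using assms(1,2) by simp_all
  then have "even (q ^ 4)"
    by simp
  then have "- 1 = (1 :: 'a)"
    using finite_field_power_CARD[of "- 1 :: 'a"] by (simp add: assms(3))
  then have char2: "1 + 1 = (0 :: 'a)"
    by (metis add.right_inverse)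
  have pow_q4: "x ^ q ^ 4 = x" for x :: 'a
    using finite_field_power_CARD[of x] by (simp add: assms(3))
  define \<phi> :: "'a \<Rightarrow> 'a" where "\<phi> x = x ^ q" for x
  have "inj (\<lambda>y :: 'a. y\<^sup>2)"
  proof (rule injI)
    fix x y :: 'a assume "x\<^sup>2 = y\<^sup>2"
    moreover have "(x + y)\<^sup>2 = x\<^sup>2 + y\<^sup>2"
      using power_add_power_of_two[OF char2, of x y 1] by simp
    ultimately have "(x + y)\<^sup>2 = (1 + 1) * y\<^sup>2"
      by (simp only: distrib_right mult_1)
    then have "x + y = 0"
      by (simp only: char2 mult_zero_left zero_eq_power2 power_eq_0_iff)
    then show "x = y"
      using \<open>- 1 = (1 :: 'a)\<close> by (metis add_eq_0_iff2 mult_1 mult_minus1)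
  qed
  then have sqrt: "\<exists>y. y\<^sup>2 = x" for x :: 'a
    using finite_UNIV_inj_surj[of "\<lambda>y :: 'a. y\<^sup>2"] by (metis finite surjD)
  interpret quartic_frobenius \<phi>
  proof
    show "\<phi> (\<phi> (\<phi> (\<phi> x))) = x" for x
      using pow_q4[of x] by (simp add: \<phi>_def power4_eq_xxxx flip: power_mult)
  qed (use char2 sqrt power_add_power_of_two[OF char2, of _ _ n] \<open>q \<ge> 1\<close>
      in \<open>auto simp: \<phi>_def assms(2) power_mult_distrib\<close>)
  interpret norm_quotient \<phi> F
  proof
    have "q ^ 3 + q\<^sup>2 + q - 1 > 0"
      using \<open>q \<ge> 1\<close> one_le_power[of q 3] one_le_power[of q 2] by linarith
    then show "F 0 = 0"
      by (simp add: assms(4))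
    fix x
    \<comment> \<open>The truncated subtraction is harmless as \<open>q \<ge> 1\<close>; adding
      \<open>2\<close> completes the exponent to that of the product of all four conjugates.\<close>
    have "q ^ 3 + q\<^sup>2 + q - 1 + 2 = 1 + q * q + q * (1 + q * q)"
      using \<open>q \<ge> 1\<close> by (simp add: power2_eq_square power3_eq_cube algebra_simps)
    then have "F x * x\<^sup>2 = x ^ (1 + q * q + q * (1 + q * q))"
      by (simp only: assms(4) flip: power_add)
    then show "F x * x\<^sup>2 = nrm x * \<phi> (nrm x)"
      by (simp add: nrm_def \<phi>_def power_add power_mult power_mult_distrib mult_ac)
  qed
  have F_mult: "F (x * y) = F x * F y" for x y
    by (simp add: assms(4) power_mult_distrib)
  have "bij F"
    using inj_F finite_UNIV_inj_surj[of F] by (simp add: bij_def)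
  moreover have "APcN c F" if "c \<in> mu (q\<^sup>2 + 1) - {1}" for c
  proof -
    have c: "c \<noteq> 1" "nrm c = 1"
      using that by (simp_all add: mu_def nrm_def \<phi>_def power2_eq_square mult.commute flip: power_mult)
    have deriv: "c_derivative c a F x = F (x + a) + c * F x" for a x
      by (simp only: c_derivative_def diff_eq)
    have le2: "c_delta_at c F a b \<le> 2" for a b
      unfolding c_delta_at_def
    proof (rule card_le_2I)
      fix x y z
      assume "x \<in> {x. c_derivative c a F x = b}" "y \<in> {x. c_derivative c a F x = b}"
        "z \<in> {x. c_derivative c a F x = b}"
      then have xyz: "F (x + a) + c * F x = b" "F (y + a) + c * F y = b" "F (z + a) + c * F z = b"
        by (simp_all add: deriv)
      show "x = y \<or> x = z \<or> y = z"
      proof (cases "a = 0")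
        \<comment> \<open>For \<open>a = 0\<close>, which the maximum includes,
          \<open>c \<noteq> 1\<close> and injectivity leave at most one solution.\<close>
        case True
        then have "(1 + c) * F x = (1 + c) * F y"
          using xyz(1,2) by (simp add: distrib_right)
        then have "F x = F y"
          using c(1) by (simp add: add_eq_0)
        then show ?thesis
          using inj_F by (auto dest: injD)
      next
        case False
        have "F a \<noteq> 0"
          using inj_F False by (metis F_0 injD)
        \<comment> \<open>Multiplicativity of \<open>F\<close> rescales the shift \<open>a\<close>
          to \<open>1\<close>.\<close>
        have "F (u / a + 1) + c * F (u / a) = b / F a" if "F (u + a) + c * F u = b" for u
        proof -
          have "F (u + a) = F (u / a + 1) * F a" "F u = F (u / a) * F a"
            using False by (simp_all add: distrib_right flip: F_mult)
          with that \<open>F a \<noteq> 0\<close> show ?thesis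
            by (simp add: eq_divide_eq distrib_left distrib_right mult_ac)
        qed
        then have "x / a = y / a \<or> x / a = z / a \<or> y / a = z / a"
          using xyz by (intro deriv_at_most_two[OF c(2,1)])
        with False show ?thesis
          by simp
      qed
    qed simp
    obtain x y where xy: "x \<noteq> y" "F (x + 1) + c * F x = F (y + 1) + c * F y"
      using deriv_two[OF c(2,1)] by blast
    let ?b = "F (x + 1) + c * F x"
    have "card {x, y} \<le> c_delta_at c F 1 ?b"
      unfolding c_delta_at_def using xy by (intro card_mono) (auto simp: deriv)
    with xy(1) le2[of 1 ?b] have "c_delta_at c F 1 ?b = 2"
      by simp
    then have "2 \<in> {c_delta_at c F a b | a b. True}"
      by (auto intro: sym)
    moreover have "finite {c_delta_at c F a b | a b. True}"
      by (rule finite_subset[of _ "{..2}"]) (use le2 in auto)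
    ultimately have "Max {c_delta_at c F a b | a b. True} = 2"
      using le2 by (intro Max_eqI) auto
    then show ?thesis
      by (simp add: APcN_def c_delta_def)
  qed
  ultimately show ?thesis
    by blast
qed

end
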